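(* Let $p$ be a prime, and let $f(x) = a_d x^d + a_{d-1} x^{d-1} + \cdots + a_1 x + a_0$, with $a_0 \neq 0$, be a polynomial of degree $d$ with rational coefficients such that $\nu_p(a_i) > 0$ for all $i$ with $0 \leq i < d$, and $\nu_p(a_d) = 0$. Then $f(x)$ is eventually stable over $\mathbb{Q}$.
   Context: $\nu_p$ denotes the $p$-adic valuation on $\mathbb{Q}$, with $\nu_p(0)=+\infty$. $f^n$ denotes the $n$-th iterate (composition) of $f$. A polynomial $f\in\mathbb{Q}[x]$ is eventually stable over $\mathbb{Q}$ if there exists a constant $C_f$, depending only on $f$, such that for every $n\ge 1$ the number of irreducible factors of $f^n(x)$ over $\mathbb{Q}$ is bounded by $C_f$. *)

theory Defs
  imports
    "HOL-Computational_Algebra.Computational_Algebra"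
    "HOL-Computational_Algebra.Field_as_Ring"
    "HOL-Library.Extended"
begin

definition padic_val :: "nat \<Rightarrow> rat \<Rightarrow> int extended" where
  "padic_val p x =
     (if x = 0 then Pinf
      else Fin (int (multiplicity (int p) (fst (quotient_of x)))
              - int (multiplicity (int p) (snd (quotient_of x)))))"

definition poly_iterate :: "nat \<Rightarrow> 'a::comm_semiring_1 poly \<Rightarrow> 'a poly" where
  "poly_iterate n f = (pcompose f ^^ n) [:0, 1:]"

text \<open>
  Irreducible factors are counted with multiplicity. Over a field every irreducible factor has
  exactly one monic associate, so summing over the monic ones counts each factor once up to units.
  For \<open>g \<noteq> 0\<close> the sum is finite; the zero polynomial gets the value 0.
\<close>

definition num_irreducible_factors :: "rat poly \<Rightarrow> nat" where
  "num_irreducible_factors g =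
     (\<Sum>q | irreducible q \<and> lead_coeff q = 1 \<and> q dvd g. multiplicity q g)"

definition eventually_stable :: "rat poly \<Rightarrow> bool" where
  "eventually_stable f \<longleftrightarrow>
     (\<exists>C::nat. \<forall>n\<ge>1. num_irreducible_factors (poly_iterate n f) \<le> C)"

end

theory Submission
  imports Defs
begin

text \<open>
  All iterates of \<open>f\<close> reduce to a unit times a power of \<open>x\<close> modulo \<open>p\<close>, so by Gauss' lemma every
  monic irreducible factor \<open>q\<close> of \<open>f\<^sup>n\<close> satisfies \<open>\<bar>q(0)\<bar>\<^sub>p \<le> 1/p\<close>. Hence \<open>f\<^sup>n\<close> has at most
  \<open>\<nu>\<^sub>p(f\<^sup>n(0))\<close> irreducible factors. If \<open>d \<ge> 2\<close>, then \<open>\<nu>\<^sub>p(x) \<ge> \<nu>\<^sub>p(a\<^sub>0)\<close> implies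
  \<open>\<nu>\<^sub>p(f(x)) = \<nu>\<^sub>p(a\<^sub>0)\<close>, because in \<open>f(x)\<close> the constant term strictly dominates; so
  \<open>\<nu>\<^sub>p(f\<^sup>n(0)) = \<nu>\<^sub>p(a\<^sub>0)\<close> for all \<open>n \<ge> 1\<close>. If \<open>d \<le> 1\<close>, the degree of \<open>f\<^sup>n\<close> is at most 1.
\<close>

section \<open>Non-archimedean absolute values on a field\<close>

locale nonarch_abs =
  fixes N :: "'a::field \<Rightarrow> real"
  assumes N_nonneg: "N x \<ge> 0"
    and N_eq_0_iff: "N x = 0 \<longleftrightarrow> x = 0"
    and N_mult: "N (x * y) = N x * N y"
    and N_ultra: "N (x + y) \<le> max (N x) (N y)"
begin

lemma N_0 [simp]: "N 0 = 0"
  by (simp add: N_eq_0_iff)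

lemma N_pos_iff: "N x > 0 \<longleftrightarrow> x \<noteq> 0"
  using N_nonneg[of x] N_eq_0_iff[of x] by linarith

lemma N_1 [simp]: "N 1 = 1"
  using N_mult[of 1 1] N_eq_0_iff[of 1] by simp

lemma N_uminus [simp]: "N (- x) = N x"
proof -
  have "N (-1) * N (-1) = 1"
    using N_mult[of "-1" "-1"] by simp
  then have "N (-1) = 1"
    using N_nonneg[of "-1"] by (simp add: square_eq_1_iff)
  then show ?thesis
    using N_mult[of "-1" x] by simp
qed

text \<open>Writing \<open>x\<close> as \<open>(x + y) + (- y)\<close>, the ultrametric inequality
  also bounds \<open>N x\<close> by \<open>N (x + y)\<close>, since \<open>N y\<close> is too small
  to be the maximum.\<close>

lemma N_add_dominant:
  assumes "N y < N x"
  shows "N (x + y) = N x"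
  using N_ultra[of x y] N_ultra[of "x + y" "- y"] assms by simp

lemma N_sum_less:
  assumes "finite A" "\<And>x. x \<in> A \<Longrightarrow> N (f x) < B" "B > 0"
  shows "N (sum f A) < B"
  using assms
proof (induction rule: finite_induct)
  case (insert x A)
  then show ?case
    using N_ultra[of "f x" "sum f A"] by fastforce
qed simp

lemma N_poly_le_1:
  assumes "\<And>i. N (coeff q i) \<le> 1" "N x \<le> 1"
  shows "N (poly q x) \<le> 1"
  using assms(1)
proof (induction q)
  case (pCons a q)
  have "N a \<le> 1" using pCons.prems[of 0] by simp
  moreover have "N (poly q x) \<le> 1"
    using pCons.prems[of "Suc _"] by (intro pCons.IH) simp
  then have "N (x * poly q x) \<le> 1"
    using assms(2) by (simp add: N_mult mult_le_one N_nonneg)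
  ultimately show ?case
    using N_ultra[of a "x * poly q x"] by simp
qed simp

section \<open>Polynomials whose reduction is a unit times a power of x\<close>

text \<open>Reduction modulo the maximal ideal of the valuation ring is expressed by absolute values
  alone, so that no residue field has to be constructed.\<close>

definition residually_monomial :: "'a poly \<Rightarrow> bool" where
  "residually_monomial h \<longleftrightarrow>
     N (lead_coeff h) = 1 \<and> (\<forall>i<degree h. N (coeff h i) < 1)"

lemma residually_monomial_nonzero:
  "residually_monomial h \<Longrightarrow> h \<noteq> 0"
  by (auto simp: residually_monomial_def)

lemma residually_monomial_coeff_le_1:
  assumes "residually_monomial h"
  shows "N (coeff h i) \<le> 1"
  using assms unfolding residually_monomial_def
  by (cases i "degree h" rule: linorder_cases) (auto simp: coeff_eq_0 less_imp_le)

text \<open>Below the top degree, each product in the convolution has a factor that is not a leading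
  coefficient, hence of absolute value below 1, while the other factor has absolute value at most
  1.\<close>

lemma residually_monomial_mult:
  assumes g: "residually_monomial g" and h: "residually_monomial h"
  shows "residually_monomial (g * h)"
proof -
  have deg: "degree (g * h) = degree g + degree h"
    using assms by (simp add: degree_mult_eq residually_monomial_nonzero)
  have "N (coeff g j * coeff h (i - j)) < 1" if "i < degree g + degree h" "j \<le> i" for i j
  proof (cases "j = degree g")
    case True
    then have "N (coeff h (i - j)) < 1"
      using h that by (auto simp: residually_monomial_def)
    then show ?thesis
      using True g by (simp add: N_mult residually_monomial_def)
  next
    case False
    then have "N (coeff g j) < 1"
      using g by (cases "j < degree g") (auto simp: residually_monomial_def coeff_eq_0)
    then show ?thesis
      using mult_right_le_one_le[of "N (coeff g j)" "N (coeff h (i - j))"]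
        residually_monomial_coeff_le_1[OF h, of "i - j"]
      by (simp add: N_mult N_nonneg)
  qed
  then have "N (coeff (g * h) i) < 1" if "i < degree (g * h)" for i
    using that unfolding coeff_mult deg by (intro N_sum_less) auto
  moreover have "N (lead_coeff (g * h)) = 1"
    using assms by (simp add: lead_coeff_mult N_mult residually_monomial_def)
  ultimately show ?thesis
    by (simp add: residually_monomial_def)
qed

text \<open>Induction along Horner's scheme \<open>a + h * pcompose f h\<close>: the product has
  positive degree because \<open>h\<close> does, so adding the small constant \<open>a\<close>
  affects only a non-leading coefficient.\<close>

lemma residually_monomial_pcompose:
  assumes "residually_monomial f" and h: "residually_monomial h" "degree h > 0"
  shows "residually_monomial (pcompose f h)"
  using assms(1)
proof (induction f)
  case 0
  then show ?case by simp
next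
  case (pCons a f)
  show ?case
  proof (cases "f = 0")
    case True
    then show ?thesis using pCons.prems by (simp add: pcompose_pCons)
  next
    case False
    have a: "N a < 1"
      using pCons.prems False unfolding residually_monomial_def by force
    have "residually_monomial f"
      using pCons.prems False unfolding residually_monomial_def by force
    then have r: "residually_monomial (h * pcompose f h)" (is "residually_monomial ?r")
      using pCons.IH h(1) by (intro residually_monomial_mult) auto
    then have "pcompose f h \<noteq> 0"
      using residually_monomial_nonzero by fastforce
    then have deg: "degree ?r > 0"
      using h residually_monomial_nonzero by (simp add: degree_mult_eq)
    then have deg': "degree ([:a:] + ?r) = degree ?r"
      by (intro degree_add_eq_right) simp
    have c: "coeff ([:a:] + ?r) i = (if i = 0 then a + coeff ?r 0 else coeff ?r i)" for i
      by (cases i) auto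
    have "N (a + coeff ?r 0) < 1"
      using N_ultra[of a "coeff ?r 0"] a r deg by (auto simp: residually_monomial_def)
    then show ?thesis
      using r deg unfolding pcompose_pCons residually_monomial_def deg' c by auto
  qed
qed

section \<open>Gauss' lemma for factors\<close>

text \<open>The index is the least one at which the Gauss norm \<open>M\<close>, the maximum of the
  absolute values of the coefficients, is attained.\<close>

lemma obtain_first_dominant_coeff:
  assumes "q \<noteq> 0"
  obtains i where "i \<le> degree q" "N (coeff q i) > 0"
    "\<And>j. N (coeff q j) \<le> N (coeff q i)"
    "\<And>j. j < i \<Longrightarrow> N (coeff q j) < N (coeff q i)"
proof -
  define M where "M = Max ((\<lambda>i. N (coeff q i)) ` {..degree q})"
  have "M \<in> (\<lambda>i. N (coeff q i)) ` {..degree q}"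
    unfolding M_def by (intro Max_in) auto
  then have ex: "\<exists>i. i \<le> degree q \<and> N (coeff q i) = M" by auto
  have "N (coeff q j) \<le> M" if "j \<le> degree q" for j
    unfolding M_def using that by (intro Max_ge) auto
  moreover have "N (lead_coeff q) > 0"
    using assms by (simp add: N_pos_iff)
  ultimately have M: "M > 0" "N (coeff q j) \<le> M" for j
    by (force, metis N_0 N_nonneg coeff_eq_0 le_refl not_le order_trans)
  define i where "i = (LEAST i. i \<le> degree q \<and> N (coeff q i) = M)"
  have i: "i \<le> degree q" "N (coeff q i) = M"
    using LeastI_ex[OF ex] by (auto simp: i_def)
  have "N (coeff q j) < M" if "j < i" for j
    using not_less_Least[OF that[unfolded i_def]] that i(1) M(2)[of j] by force
  then show ?thesis
    using that[of i] i M by auto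
qed

text \<open>
  As in Gauss' lemma, the first dominant coefficients of \<open>g\<close> and \<open>h\<close>, at indices \<open>i\<close> and \<open>j\<close>,
  determine the absolute value of the coefficient of \<open>g * h\<close> at \<open>i + j\<close>.
\<close>

lemma residually_monomial_factor:
  assumes gh: "residually_monomial (g * h)" and lead: "N (lead_coeff g) = 1"
  shows "residually_monomial g"
proof -
  have nz: "g \<noteq> 0" "h \<noteq> 0"
    using residually_monomial_nonzero[OF gh] by auto
  obtain i where i: "i \<le> degree g" "N (coeff g i) > 0"
    "\<And>k. N (coeff g k) \<le> N (coeff g i)" "\<And>k. k < i \<Longrightarrow> N (coeff g k) < N (coeff g i)"
    using obtain_first_dominant_coeff[OF nz(1)] by blast
  obtain j where j: "j \<le> degree h" "N (coeff h j) > 0"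
    "\<And>k. N (coeff h k) \<le> N (coeff h j)" "\<And>k. k < j \<Longrightarrow> N (coeff h k) < N (coeff h j)"
    using obtain_first_dominant_coeff[OF nz(2)] by blast
  \<comment> \<open>If \<open>k < i\<close>, the factor from \<open>g\<close> is strictly below its
    maximum; otherwise \<open>i + j - k < j\<close> and the factor from \<open>h\<close> is.\<close>
  have "N (coeff g k * coeff h (i + j - k)) < N (coeff g i * coeff h j)"
    if "k \<in> {..i + j} - {i}" for k
  proof (cases "k < i")
    case True
    then show ?thesis
      using i(4) j(2) by (simp add: N_mult le_less_trans[OF mult_left_mono[OF j(3) N_nonneg]])
  next
    case False
    then have "i + j - k < j" using that by auto
    then have "N (coeff h (i + j - k)) < N (coeff h j)" by (rule j(4))
    then have "N (coeff g i) * N (coeff h (i + j - k)) < N (coeff g i) * N (coeff h j)"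
      using i(2) by simp
    then show ?thesis
      using mult_right_mono[OF i(3)[of k] N_nonneg[of "coeff h (i + j - k)"]]
      by (simp add: N_mult)
  qed
  then have "N (\<Sum>k\<in>{..i + j} - {i}. coeff g k * coeff h (i + j - k)) < N (coeff g i * coeff h j)"
    using i(2) j(2) by (intro N_sum_less) (auto simp: N_mult)
  moreover have "coeff (g * h) (i + j) = coeff g i * coeff h j
      + (\<Sum>k\<in>{..i + j} - {i}. coeff g k * coeff h (i + j - k))"
    unfolding coeff_mult by (subst sum.remove[of _ i]) auto
  ultimately have dominant: "N (coeff (g * h) (i + j)) = N (coeff g i) * N (coeff h j)"
    using N_add_dominant by (simp add: N_mult)
  have lead_h: "N (lead_coeff h) = 1"
    using gh lead by (simp add: residually_monomial_def lead_coeff_mult N_mult)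
  have ge1: "N (coeff g i) \<ge> 1" "N (coeff h j) \<ge> 1"
    using i(3)[of "degree g"] j(3)[of "degree h"] lead lead_h by auto
  have le1: "N (coeff g i) * N (coeff h j) \<le> 1"
    using residually_monomial_coeff_le_1[OF gh] dominant by metis
  have "1 \<le> N (coeff g i) * N (coeff h j)"
    using mult_mono[OF ge1] N_nonneg by simp
  \<comment> \<open>Only the leading coefficient of \<open>g * h\<close> can have absolute value 1,
    so both first dominant indices must be the respective degrees.\<close>
  then have "\<not> i + j < degree (g * h)"
    using gh dominant by (auto simp: residually_monomial_def)
  then have "i = degree g"
    using i(1) j(1) nz by (simp add: degree_mult_eq)
  then show ?thesis
    using i(4) lead by (simp add: residually_monomial_def)
qed

text \<open>Write f(x) = a + x (b + x q(x)). Degree at least 2 makes \<open>b\<close> a non-leading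
  coefficient, so the bracket has absolute value below 1 and the second summand is strictly smaller
  than \<open>a\<close>.\<close>

lemma N_poly_eq_N_coeff_0:
  assumes f: "residually_monomial f" and deg: "degree f \<ge> 2"
    and nz: "coeff f 0 \<noteq> 0" and x: "N x \<le> N (coeff f 0)"
  shows "N (poly f x) = N (coeff f 0)"
proof -
  obtain a b q where f_eq: "f = pCons a (pCons b q)"
    by (metis pCons_cases)
  have a: "N a < 1" "N a > 0" and b: "N b < 1"
    using f deg nz unfolding residually_monomial_def f_eq
    by (force simp: N_pos_iff split: if_splits)+
  have Nx: "N x < 1" "N x \<le> N a"
    using x a by (auto simp: f_eq)
  have "N (coeff q i) \<le> 1" for i
    using residually_monomial_coeff_le_1[OF f, of "Suc (Suc i)"] by (simp add: f_eq)
  then have "N (poly q x) \<le> 1"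
    using Nx by (intro N_poly_le_1) auto
  then have "N (x * poly q x) < 1"
    using Nx mult_right_le_one_le[of "N x" "N (poly q x)"] by (simp add: N_mult N_nonneg)
  then have "N (b + x * poly q x) < 1"
    using N_ultra[of b "x * poly q x"] b by simp
  then have "N a * N (b + x * poly q x) < N a"
    using a by simp
  then have "N (x * (b + x * poly q x)) < N a"
    using mult_right_mono[OF Nx(2) N_nonneg[of "b + x * poly q x"]]
    by (simp add: N_mult)
  then show ?thesis
    using N_add_dominant by (simp add: f_eq)
qed

end

section \<open>Iterates and the orbit of 0\<close>

lemma poly_iterate_0 [simp]: "poly_iterate 0 f = [:0, 1:]"
  by (simp add: poly_iterate_def)

lemma poly_iterate_Suc [simp]: "poly_iterate (Suc n) f = pcompose f (poly_iterate n f)"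
  by (simp add: poly_iterate_def)

lemma degree_poly_iterate:
  fixes f :: "'a::idom poly"
  shows "degree (poly_iterate n f) = degree f ^ n"
  by (induction n) (auto simp: degree_pcompose)

context nonarch_abs
begin

lemma residually_monomial_poly_iterate:
  assumes "residually_monomial f" "degree f > 0"
  shows "residually_monomial (poly_iterate n f)"
proof (induction n)
  case 0
  then show ?case by (simp add: residually_monomial_def)
next
  case (Suc n)
  then show ?case
    using assms by (auto intro!: residually_monomial_pcompose simp: degree_poly_iterate)
qed

text \<open>The orbit of 0 enters the disc \<open>N x \<le> N (coeff f 0)\<close> at its first step,
  and \<open>f\<close> maps this disc into its boundary circle.\<close>

lemma N_poly_iterate_at_0:
  assumes "residually_monomial f" "degree f \<ge> 2" "coeff f 0 \<noteq> 0" "n \<ge> 1"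
  shows "N (poly (poly_iterate n f) 0) = N (coeff f 0)"
  using assms(4)
proof (induction n rule: dec_induct)
  case base
  then show ?case by (simp add: poly_pcompose poly_0_coeff_0)
next
  case (step n)
  then show ?case
    using N_poly_eq_N_coeff_0[OF assms(1-3)] by (simp add: poly_pcompose)
qed

end

section \<open>Counting irreducible factors over the rationals\<close>

lemma degree_pos_if_irreducible:
  fixes q :: "'a::field poly"
  assumes "irreducible q"
  shows "degree q > 0"
  using assms by (auto simp: irreducible_def is_unit_iff_degree)

text \<open>\<open>prime\<close> demands a normalized prime element, and normalized means monic
  here. This makes \<open>prime_factorization\<close> available for the count.\<close>

lemma prime_rat_poly_iff:
  fixes q :: "rat poly"
  shows "prime q \<longleftrightarrow> irreducible q \<and> lead_coeff q = 1"
proof (cases "q = 0")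
  case False
  have "unit_factor q = [:lead_coeff q:]"
    by (simp add: unit_factor_poly_def)
  moreover have "normalize q = q \<longleftrightarrow> unit_factor q = 1"
    using False unit_factor_normalize[of q] unit_factor_1_imp_normalized[of q] by metis
  ultimately have "normalize q = q \<longleftrightarrow> lead_coeff q = 1"
    by (simp add: one_pCons)
  then show ?thesis
    by (auto simp: prime_def prime_elem_iff_irreducible)
qed auto

lemma num_irreducible_factors_eq_size:
  assumes "g \<noteq> 0"
  shows "num_irreducible_factors g = size (prime_factorization g)"
proof -
  have "{q. irreducible q \<and> lead_coeff q = 1 \<and> q dvd g} = prime_factors g"
    using assms by (auto simp: prime_factors_dvd prime_rat_poly_iff)
  then show ?thesis
    unfolding num_irreducible_factors_def size_multiset_overloaded_eq
    by (intro sum.cong) (auto simp: count_prime_factorization_prime in_prime_factors_iff)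
qed

lemma rat_poly_eq_smult_prod_mset_prime_factorization:
  fixes g :: "rat poly"
  assumes "g \<noteq> 0"
  shows "g = smult (lead_coeff g) (prod_mset (prime_factorization g))"
proof -
  let ?P = "prod_mset (prime_factorization g)"
  have "lead_coeff (prod_mset A) = 1" if "\<forall>q\<in>#A. lead_coeff q = 1" for A :: "rat poly multiset"
    using that by (induction A) (auto simp: lead_coeff_mult)
  then have "lead_coeff ?P = 1"
    by (metis in_prime_factors_imp_prime prime_rat_poly_iff)
  then have "unit_factor ?P = 1"
    by (simp add: unit_factor_poly_def one_pCons)
  then have "?P = normalize g"
    using assms prod_mset_prime_factorization_weak unit_factor_1_imp_normalized by metis
  moreover have "g = unit_factor g * normalize g"
    by simp
  ultimately show ?thesis
    by (simp add: unit_factor_poly_def)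
qed

text \<open>Every irreducible factor contributes at least 1 to the degree. This serves the case
  \<open>d < 2\<close>.\<close>

lemma num_irreducible_factors_le_degree:
  assumes "g \<noteq> 0"
  shows "num_irreducible_factors g \<le> degree g"
proof -
  have "size A \<le> degree (prod_mset A)" if "\<forall>q\<in>#A. irreducible q" for A :: "rat poly multiset"
    using that
  proof (induction A)
    case (add q A)
    have "degree q > 0"
      using add.prems by (simp add: degree_pos_if_irreducible)
    moreover have "q * prod_mset A \<noteq> 0"
      using add.prems by (auto simp: prod_mset_zero_iff)
    ultimately show ?case
      using add by (auto simp: degree_mult_eq)
  qed simp
  then have "size (prime_factorization g) \<le> degree (prod_mset (prime_factorization g))"
    using in_prime_factors_imp_prime prime_rat_poly_iff by metis
  also have "\<dots> = degree g"
    using rat_poly_eq_smult_prod_mset_prime_factorization[OF assms] assms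
    by (metis degree_smult_eq leading_coeff_0_iff)
  finally show ?thesis
    by (simp add: num_irreducible_factors_eq_size assms)
qed

text \<open>Each monic irreducible factor is residually monomial of positive degree, so its value at
  0 is a non-leading coefficient and \<open>discrete\<close> bounds it by \<open>c\<close>. These
  bounds multiply.\<close>

lemma N_coeff_0_le_power_num_irreducible_factors:
  fixes N :: "rat \<Rightarrow> real"
  assumes "nonarch_abs N" and discrete: "\<And>x. N x < 1 \<Longrightarrow> N x \<le> c"
    and g: "nonarch_abs.residually_monomial N g"
  shows "N (poly g 0) \<le> c ^ num_irreducible_factors g"
proof -
  interpret nonarch_abs N by fact
  have c: "c \<ge> 0"
    using discrete[of 0] by simp
  have nz: "g \<noteq> 0"
    using g by (rule residually_monomial_nonzero)
  let ?A = "prime_factorization g"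
  have small: "N (poly q 0) \<le> c" if "q \<in># ?A" for q
  proof -
    have q: "irreducible q" "lead_coeff q = 1" "q dvd g"
      using that by (auto simp: in_prime_factors_iff prime_rat_poly_iff)
    then have "residually_monomial q"
      using g by (auto elim!: dvdE intro: residually_monomial_factor)
    moreover have "degree q > 0"
      using q(1) by (rule degree_pos_if_irreducible)
    ultimately show ?thesis
      using discrete by (auto simp: residually_monomial_def poly_0_coeff_0)
  qed
  have "N (poly g 0) = N (lead_coeff g) * N (poly (prod_mset ?A) 0)"
    by (subst rat_poly_eq_smult_prod_mset_prime_factorization[OF nz]) (simp add: N_mult)
  also have "\<dots> = N (poly (prod_mset ?A) 0)"
    using g by (simp add: residually_monomial_def)
  also have "N (poly (prod_mset B) 0) \<le> c ^ size B"
    if "\<forall>q\<in>#B. N (poly q 0) \<le> c" for B :: "rat poly multiset"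
    using that
  proof (induction B)
    case (add q B)
    then show ?case
      by (auto simp: N_mult intro!: mult_mono N_nonneg c)
  qed simp
  then have "N (poly (prod_mset ?A) 0) \<le> c ^ size ?A"
    using small by blast
  finally show ?thesis
    by (simp add: num_irreducible_factors_eq_size nz)
qed

section \<open>The p-adic absolute value\<close>

definition padic_abs_int :: "nat \<Rightarrow> int \<Rightarrow> real" where
  "padic_abs_int p a = (if a = 0 then 0 else (1 / real p) ^ multiplicity (int p) a)"

definition padic_abs :: "nat \<Rightarrow> rat \<Rightarrow> real" where
  "padic_abs p x =
     padic_abs_int p (fst (quotient_of x)) / padic_abs_int p (snd (quotient_of x))"

context
  fixes p :: nat
  assumes p: "prime p"
begin

lemma padic_abs_int_nonneg: "padic_abs_int p a \<ge> 0"
  by (simp add: padic_abs_int_def)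

lemma padic_abs_int_eq_0_iff: "padic_abs_int p a = 0 \<longleftrightarrow> a = 0"
  using prime_gt_0_nat[OF p] by (simp add: padic_abs_int_def)

lemma padic_abs_int_mult: "padic_abs_int p (a * b) = padic_abs_int p a * padic_abs_int p b"
  using p by (simp add: padic_abs_int_def prime_elem_multiplicity_mult_distrib power_add)

lemma padic_abs_int_add: "padic_abs_int p (a + b) \<le> max (padic_abs_int p a) (padic_abs_int p b)"
\<comment> \<open>\<open>multiplicity\<close> takes the value 0 at 0 instead of infinity, so
  vanishing terms are treated apart.\<close>
proof (cases "a = 0 \<or> b = 0 \<or> a + b = 0")
  case True
  then show ?thesis
    using padic_abs_int_nonneg[of a] padic_abs_int_nonneg[of b]
      padic_abs_int_eq_0_iff[of 0] by (auto simp: le_max_iff_disj)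
next
  case False
  let ?v = "multiplicity (int p)"
  have "int p ^ min (?v a) (?v b) dvd a + b"
    by (intro dvd_add) (simp_all add: multiplicity_dvd')
  then have "min (?v a) (?v b) \<le> ?v (a + b)"
    using False p by (intro multiplicity_geI) (auto dest: prime_gt_1_nat)
  then have "(1 / real p) ^ ?v (a + b) \<le> (1 / real p) ^ min (?v a) (?v b)"
    using prime_gt_0_nat[OF p] by (intro power_decreasing) auto
  then show ?thesis
    using False by (auto simp: padic_abs_int_def min_def split: if_splits)
qed

text \<open>Any representing fraction may be used, so sums and products need not be brought to
  lowest terms.\<close>

lemma padic_abs_quotient:
  assumes "b \<noteq> 0"
  shows "padic_abs p (of_int a / of_int b) = padic_abs_int p a / padic_abs_int p b"
proof -
  obtain a' b' where q: "quotient_of (of_int a / of_int b) = (a', b')"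
    by fastforce
  then have b': "b' \<noteq> 0"
    using quotient_of_denom_pos by fastforce
  have "(of_int a / of_int b :: rat) = of_int a' / of_int b'"
    using quotient_of_div[OF q] .
  then have "(of_int (a * b') :: rat) = of_int (a' * b)"
    using assms b' by (simp add: field_simps)
  then have "a * b' = a' * b"
    by (simp only: of_int_eq_iff)
  then have "padic_abs_int p a * padic_abs_int p b' = padic_abs_int p a' * padic_abs_int p b"
    by (simp flip: padic_abs_int_mult)
  then show ?thesis
    using assms b' by (simp add: padic_abs_def q padic_abs_int_eq_0_iff field_simps)
qed

text \<open>Over a common denominator, the ultrametric inequality reduces to the one for integer
  numerators.\<close>

lemma rat_quotient_common_denom:
  fixes x y :: rat
  obtains a b c :: int where "c \<noteq> 0" "x = of_int a / of_int c" "y = of_int b / of_int c"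
proof -
  obtain a b where ab: "quotient_of x = (a, b)" by fastforce
  obtain c d where cd: "quotient_of y = (c, d)" by fastforce
  have "b > 0" "d > 0"
    using ab cd by (auto dest: quotient_of_denom_pos)
  then show ?thesis
    using quotient_of_div[OF ab] quotient_of_div[OF cd]
    by (intro that[of "b * d" "a * d" "c * b"]) auto
qed

lemma nonarch_abs_padic_abs: "nonarch_abs (padic_abs p)"
proof
  fix x y :: rat
  obtain a b c :: int where c: "c \<noteq> 0" and x: "x = of_int a / of_int c"
    and y: "y = of_int b / of_int c"
    using rat_quotient_common_denom .
  show "padic_abs p x \<ge> 0"
    by (simp add: padic_abs_def padic_abs_int_nonneg)
  show "padic_abs p x = 0 \<longleftrightarrow> x = 0"
    using c by (simp add: x padic_abs_quotient padic_abs_int_eq_0_iff)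
  have "x * y = of_int (a * b) / of_int (c * c)"
    by (simp add: x y)
  then show "padic_abs p (x * y) = padic_abs p x * padic_abs p y"
    using padic_abs_quotient[of "c * c" "a * b"] c by (simp add: padic_abs_quotient padic_abs_int_mult x y)
  have "x + y = of_int (a + b) / of_int c"
    by (simp add: x y add_divide_distrib)
  then have "padic_abs p (x + y) = padic_abs_int p (a + b) / padic_abs_int p c"
    by (simp only: padic_abs_quotient[OF c])
  also have "\<dots> \<le> max (padic_abs_int p a) (padic_abs_int p b) / padic_abs_int p c"
    by (intro divide_right_mono padic_abs_int_add padic_abs_int_nonneg)
  also have "\<dots> = max (padic_abs p x) (padic_abs p y)"
    using padic_abs_int_nonneg[of c] by (simp add: x y padic_abs_quotient[OF c] max_divide_distrib_right)
  finally show "padic_abs p (x + y) \<le> max (padic_abs p x) (padic_abs p y)" .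
qed

lemma padic_abs_eq_powi:
  assumes "padic_val p x = Fin k"
  shows "padic_abs p x = (1 / real p) powi k"
proof -
  have x: "x \<noteq> 0" and k: "k = int (multiplicity (int p) (fst (quotient_of x)))
      - int (multiplicity (int p) (snd (quotient_of x)))"
    using assms by (auto simp: padic_val_def split: if_splits)
  obtain a b where ab: "quotient_of x = (a, b)" by fastforce
  then have "a \<noteq> 0" "b \<noteq> 0"
    using x quotient_of_div[OF ab] quotient_of_denom_pos[OF ab] by auto
  then show ?thesis
    using prime_gt_0_nat[OF p]
    by (simp add: padic_abs_def padic_abs_int_def k ab power_int_diff)
qed

lemma padic_abs_le_if_padic_val_pos:
  assumes "padic_val p x > 0"
  shows "padic_abs p x \<le> 1 / real p"
proof (cases "padic_val p x")
  case (Fin k)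
  then have "k \<ge> 1"
    using assms by (simp add: zero_extended_def)
  then have "(1 / real p) powi k \<le> (1 / real p) powi 1"
    using prime_gt_0_nat[OF p] by (intro power_int_decreasing) auto
  then show ?thesis
    using padic_abs_eq_powi[OF Fin] by simp
next
  case Pinf
  then have "x = 0"
    by (simp add: padic_val_def split: if_splits)
  then show ?thesis
    using nonarch_abs.N_0[OF nonarch_abs_padic_abs] by simp
next
  case Minf
  then show ?thesis
    using assms by (simp add: zero_extended_def)
qed

text \<open>The valuation is integral: if it is not positive, it is some \<open>k \<le> 0\<close>,
  which gives absolute value at least 1.\<close>

lemma padic_abs_discrete:
  assumes "padic_abs p x < 1"
  shows "padic_abs p x \<le> 1 / real p"
proof (rule padic_abs_le_if_padic_val_pos, rule ccontr)
  assume "\<not> padic_val p x > 0"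
  then obtain k where k: "padic_val p x = Fin k" "k \<le> 0"
    by (auto simp: padic_val_def zero_extended_def split: if_splits)
  then have "(1 / real p) powi 0 \<le> (1 / real p) powi k"
    using prime_gt_0_nat[OF p] by (intro power_int_decreasing) auto
  then show False
    using padic_abs_eq_powi[OF k(1)] assms by simp
qed

end

theorem theorem1p9:
  fixes p d :: nat and f :: "rat poly"
  assumes "prime p"
    and "degree f = d"
    and "coeff f 0 \<noteq> 0"
    and "\<And>i. i < d \<Longrightarrow> padic_val p (coeff f i) > 0"
    and "padic_val p (coeff f d) = 0"
  shows "eventually_stable f"
proof (cases "d \<ge> 2")
  case True
  let ?N = "padic_abs p"
  interpret nonarch_abs ?N
    using assms(1) by (rule nonarch_abs_padic_abs)
  have p: "real p > 1"
    using prime_gt_1_nat[OF assms(1)] by simp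
  have "?N (coeff f i) < 1" if "i < d" for i
    using padic_abs_le_if_padic_val_pos[OF assms(1) assms(4)[OF that]] p
    by (auto intro: le_less_trans)
  moreover have "?N (coeff f d) = 1"
    using padic_abs_eq_powi[OF assms(1) assms(5)[unfolded zero_extended_def]] by simp
  ultimately have f: "residually_monomial f"
    by (simp add: residually_monomial_def assms(2))
  \<comment> \<open>Any \<open>C\<close> exceeding the valuation of the constant coefficient will
    do: more than \<open>C\<close> factors would push the value of the iterate at 0, which has
    absolute value \<open>?N (coeff f 0)\<close>, below that same number.\<close>
  obtain C where C: "(1 / real p) ^ C < ?N (coeff f 0)"
    using real_arch_pow_inv[of "?N (coeff f 0)" "1 / real p"] assms(3) p N_pos_iff by auto
  have "num_irreducible_factors (poly_iterate n f) \<le> C" if "n \<ge> 1" for n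
  proof (rule ccontr)
    assume "\<not> ?thesis"
    then have "(1 / real p) ^ num_irreducible_factors (poly_iterate n f) \<le> (1 / real p) ^ C"
      using p by (intro power_decreasing) auto
    moreover have "?N (poly (poly_iterate n f) 0) = ?N (coeff f 0)"
      using f True assms(2,3) that by (intro N_poly_iterate_at_0) auto
    moreover have "?N (poly (poly_iterate n f) 0)
        \<le> (1 / real p) ^ num_irreducible_factors (poly_iterate n f)"
      using f True assms(2)
      by (intro N_coeff_0_le_power_num_irreducible_factors nonarch_abs_axioms
          padic_abs_discrete[OF assms(1)] residually_monomial_poly_iterate) auto
    ultimately show False
      using C by linarith
  qed
  then show ?thesis
    unfolding eventually_stable_def by blast
next
  case False
  \<comment> \<open>The degree bound needs nonzero iterates. For constant \<open>f\<close> this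
    comes from \<open>coeff f 0 \<noteq> 0\<close>, for degree 1 from the degree of the
    iterate.\<close>
  have nz: "poly_iterate n f \<noteq> 0" for n
  proof (cases n)
    case (Suc m)
    show ?thesis
    proof (cases "d = 0")
      case True
      then obtain a where "f = [:a:]"
        using assms(2) degree_eq_zeroE by blast
      then show ?thesis
        using assms(3) Suc by (simp add: pcompose_const)
    next
      case False
      then show ?thesis
        using degree_poly_iterate[of n f] assms(2) by force
    qed
  qed simp
  have "num_irreducible_factors (poly_iterate n f) \<le> 1" for n
  proof -
    have "degree (poly_iterate n f) \<le> 1"
      using False assms(2) power_mono[of d 1 n] by (simp add: degree_poly_iterate)
    then show ?thesis
      using num_irreducible_factors_le_degree[OF nz[of n]] by simp
  qed
  then show ?thesis
    unfolding eventually_stable_def by blast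
qed

end
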